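(* Let $n\ge 3$, let $B_1(0)\subset\mathbb{C}$ be the open unit disc, and for $r=(z_1,\ldots,z_n)\in B_1(0)^n$, with $z_k=x_k+iy_k$ and $z_{n+1}=z_1$, define $$A(r)=\sum_{k=1}^n 2\,\mathrm{Tan}^{-1}\left(\frac{x_k y_{k+1}-y_k x_{k+1}}{1-x_k x_{k+1}-y_k y_{k+1}}\right),\qquad P(r)=\sum_{k=1}^n d(z_k,z_{k+1}),$$ where $d(z,w)=2\,\mathrm{Tanh}^{-1}\left|\frac{w-z}{1-\bar z w}\right|$ is the hyperbolic distance. If $P>0$ is fixed, then $A(r)$ attains its supremum over the set $$S=\{r\in B_1(0)^n : P(r)=P\}.$$
   Context: The points $z_1,\ldots,z_n$ are arbitrary points of the open unit disc; they are not required to be distinct or to be the vertices of a simple or positively oriented polygon. $\mathrm{Tan}^{-1}$ is the principal arctangent, with values in $(-\pi/2,\pi/2)$, and $\mathrm{Tanh}^{-1}$ is the inverse hyperbolic tangent. When $z_1,\ldots,z_n$ are the positively oriented vertices of a simple hyperbolic $n$-gon in the Poincaré disc model (metric $\frac{2}{1-|z|^2}|dz|$), $A(r)$ is its hyperbolic area and $P(r)$ is its hyperbolic perimeter. *)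

theory Defs
  imports Complex_Main "HOL-Library.FuncSet" "HOL-Analysis.Elementary_Metric_Spaces"
begin

text \<open>An element of the \<open>n\<close>-fold power of the disc is a function on the index set \<open>{1..n}\<close>,
  made unique by extensionality outside of it.\<close>

definition disc_pow :: "nat \<Rightarrow> (nat \<Rightarrow> complex) set" where
  "disc_pow n = {1..n} \<rightarrow>\<^sub>E ball 0 1"

text \<open>For \<open>k\<close> in \<open>{1..n}\<close>, the index \<open>k mod n + 1\<close> is \<open>k + 1\<close> if \<open>k < n\<close>, and \<open>1\<close> if \<open>k = n\<close>.\<close>

definition cyc_next :: "nat \<Rightarrow> nat \<Rightarrow> nat" where
  "cyc_next n k = k mod n + 1"

definition hyp_dist :: "complex \<Rightarrow> complex \<Rightarrow> real" where
  "hyp_dist z w = 2 * artanh (cmod ((w - z) / (1 - cnj z * w)))"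

definition hyp_area :: "nat \<Rightarrow> (nat \<Rightarrow> complex) \<Rightarrow> real" where
  "hyp_area n z = (\<Sum>k=1..n. 2 * arctan
     ((Re (z k) * Im (z (cyc_next n k)) - Im (z k) * Re (z (cyc_next n k))) /
      (1 - Re (z k) * Re (z (cyc_next n k)) - Im (z k) * Im (z (cyc_next n k)))))"

definition hyp_perimeter :: "nat \<Rightarrow> (nat \<Rightarrow> complex) \<Rightarrow> real" where
  "hyp_perimeter n z = (\<Sum>k=1..n. hyp_dist (z k) (z (cyc_next n k)))"

definition isoperimetric_set :: "nat \<Rightarrow> real \<Rightarrow> (nat \<Rightarrow> complex) set" where
  "isoperimetric_set n P = {z \<in> disc_pow n. hyp_perimeter n z = P}"

end

theory Submission
  imports Defs "HOL-Complex_Analysis.Riemann_Mapping"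
begin

(* Since the k-th summand of the area is -2 Arg(1 - cnj (z k) * z (k+1)), a disc automorphism
   z |-> (z - a) / (1 - cnj a * z) changes it by 2 Arg(1 - cnj a * z (k+1)) - 2 Arg(1 - cnj a * z k),
   and these corrections telescope around the cycle. So the area, like the perimeter, is invariant
   under disc automorphisms and one may assume z 1 = 0. A bound on the perimeter then keeps all
   vertices in a fixed compact disc, where the continuous area attains its maximum. *)

subsection \<open>Invariance under disc automorphisms\<close>

lemma Re_one_minus_cnj_mult_pos:
  assumes "cmod z < 1" "cmod w < 1"
  shows "Re (1 - cnj z * w) > 0"
proof -
  have "cmod (cnj z * w) < 1"
    using norm_mult_less[of "cnj z" 1 w 1] assms by simp
  then show ?thesis
    using complex_Re_le_cmod[of "cnj z * w"] by simp
qed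

lemma one_minus_cnj_mult_nonzero:
  assumes "cmod z < 1" "cmod w < 1"
  shows "1 - cnj z * w \<noteq> 0"
  using Re_one_minus_cnj_mult_pos[OF assms] by force

text \<open>Clearing the denominators \<open>p\<close> and \<open>q\<close> leaves
  \<open>cnj p * q - cnj (z - a) * (w - a)\<close>, whose mixed terms cancel so that it factors.
  Keeping the denominators as a product on the left lets one take moduli, for the distance, or
  logarithms, for the area.\<close>

lemma Moebius_function_one_minus_cnj:
  assumes "cmod a < 1" "cmod z < 1" "cmod w < 1"
  shows "(1 - cnj (Moebius_function 0 a z) * Moebius_function 0 a w)
           * (cnj (1 - cnj a * z) * (1 - cnj a * w))
         = of_real (1 - (cmod a)\<^sup>2) * (1 - cnj z * w)"
proof -
  define p where "p = 1 - cnj a * z"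
  define q where "q = 1 - cnj a * w"
  have "cnj p \<noteq> 0" "q \<noteq> 0"
    unfolding p_def q_def using one_minus_cnj_mult_nonzero assms complex_cnj_zero_iff by blast+
  then have "(1 - cnj ((z - a) / p) * ((w - a) / q)) * (cnj p * q)
      = cnj p * q - cnj (z - a) * (w - a)"
    by (simp add: field_simps)
  also have "\<dots> = (1 - a * cnj a) * (1 - cnj z * w)"
    by (simp add: p_def q_def algebra_simps)
  also have "1 - a * cnj a = of_real (1 - (cmod a)\<^sup>2)"
    using complex_norm_square[of a] by simp
  finally show ?thesis
    by (simp add: Moebius_function_simple p_def q_def)
qed

text \<open>The diagonal case \<open>w = z\<close> of the previous identity, read over the reals. It
  will relate the distances of two points from the unit circle.\<close>

lemma one_minus_norm_Moebius_function_sq: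
  assumes "cmod a < 1" "cmod z < 1"
  shows "(1 - (cmod (Moebius_function 0 a z))\<^sup>2) * (cmod (1 - cnj a * z))\<^sup>2
         = (1 - (cmod a)\<^sup>2) * (1 - (cmod z)\<^sup>2)"
proof -
  have sq: "cnj x * x = of_real ((cmod x)\<^sup>2)" for x
    by (metis complex_norm_square mult.commute)
  have "complex_of_real ((1 - (cmod (Moebius_function 0 a z))\<^sup>2) * (cmod (1 - cnj a * z))\<^sup>2)
      = of_real ((1 - (cmod a)\<^sup>2) * (1 - (cmod z)\<^sup>2))"
    using Moebius_function_one_minus_cnj[OF assms assms(2)] unfolding sq
    by (simp only: of_real_mult of_real_diff of_real_1)
  then show ?thesis
    using of_real_eq_iff by blast
qed

lemma Moebius_function_diff:
  assumes "cmod a < 1" "cmod z < 1" "cmod w < 1"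
  shows "(Moebius_function 0 a w - Moebius_function 0 a z)
           * ((1 - cnj a * z) * (1 - cnj a * w))
         = of_real (1 - (cmod a)\<^sup>2) * (w - z)"
proof -
  define p where "p = 1 - cnj a * z"
  define q where "q = 1 - cnj a * w"
  have "p \<noteq> 0" "q \<noteq> 0"
    unfolding p_def q_def using one_minus_cnj_mult_nonzero assms by blast+
  then have "((w - a) / q - (z - a) / p) * (p * q) = (w - a) * p - (z - a) * q"
    by (simp add: field_simps)
  also have "\<dots> = (1 - a * cnj a) * (w - z)"
    by (simp add: p_def q_def algebra_simps)
  also have "1 - a * cnj a = of_real (1 - (cmod a)\<^sup>2)"
    using complex_norm_square[of a] by simp
  finally show ?thesis
    by (simp add: Moebius_function_simple p_def q_def)
qed

text \<open>Taking moduli in the two preceding identities gives the same factors \<open>K\<close>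
  and \<open>L\<close> in the numerator and the denominator of the pseudo-hyperbolic distance, so
  they cancel in the quotient.\<close>

lemma hyp_dist_Moebius_function:
  assumes "cmod a < 1" "cmod z < 1" "cmod w < 1"
  shows "hyp_dist (Moebius_function 0 a z) (Moebius_function 0 a w) = hyp_dist z w"
proof -
  let ?z = "Moebius_function 0 a z" and ?w = "Moebius_function 0 a w"
  define K where "K = cmod (1 - cnj a * z) * cmod (1 - cnj a * w)"
  define L where "L = cmod (of_real (1 - (cmod a)\<^sup>2))"
  have "K \<noteq> 0"
    using one_minus_cnj_mult_nonzero assms by (simp add: K_def)
  have "L \<noteq> 0"
    using assms by (simp add: L_def abs_square_eq_1 del: of_real_diff)
  have "cmod (?w - ?z) * K = L * cmod (w - z)"
    using arg_cong[OF Moebius_function_diff[OF assms], of cmod]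
    by (simp only: norm_mult K_def L_def)
  moreover have "cmod (1 - cnj ?z * ?w) * K = L * cmod (1 - cnj z * w)"
    using arg_cong[OF Moebius_function_one_minus_cnj[OF assms], of cmod]
    by (simp only: norm_mult K_def L_def complex_mod_cnj)
  ultimately have "cmod (?w - ?z) / cmod (1 - cnj ?z * ?w) = cmod (w - z) / cmod (1 - cnj z * w)"
    using \<open>K \<noteq> 0\<close> \<open>L \<noteq> 0\<close> by (metis mult_divide_mult_cancel_left mult_divide_mult_cancel_right)
  then show ?thesis
    by (simp add: hyp_dist_def norm_divide)
qed

text \<open>The denominator is the real part of \<open>1 - cnj z * w\<close> and the numerator is
  minus its imaginary part. Since the number lies in the right half-plane, its principal argument is
  the arctangent of that ratio.\<close>

lemma arctan_term_eq_Im_Ln: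
  assumes "cmod z < 1" "cmod w < 1"
  shows "arctan ((Re z * Im w - Im z * Re w) / (1 - Re z * Re w - Im z * Im w))
         = - Im (Ln (1 - cnj z * w))"
proof -
  have "Im (Ln (1 - cnj z * w)) = arctan (Im (1 - cnj z * w) / Re (1 - cnj z * w))"
    using Re_one_minus_cnj_mult_pos[OF assms] one_minus_cnj_mult_nonzero[OF assms]
    by (subst Im_Ln_eq) auto
  also have "\<dots> = arctan (- ((Re z * Im w - Im z * Re w) / (1 - Re z * Re w - Im z * Im w)))"
    by (simp add: diff_diff_eq minus_divide_left)
  finally show ?thesis
    by (simp add: arctan_minus)
qed

text \<open>Logarithm of the multiplicative identity. A priori this holds only modulo 2 pi, but four
  arguments occur, each less than pi / 2 in absolute value, so the two sides differ by less than 2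
  pi and no branch jump is possible.\<close>

lemma Im_Ln_Moebius_function:
  assumes "cmod a < 1" "cmod z < 1" "cmod w < 1"
  shows "Im (Ln (1 - cnj (Moebius_function 0 a z) * Moebius_function 0 a w))
         = Im (Ln (1 - cnj z * w)) + Im (Ln (1 - cnj a * z)) - Im (Ln (1 - cnj a * w))"
proof -
  let ?z = "Moebius_function 0 a z" and ?w = "Moebius_function 0 a w"
  define k where "k = 1 - (cmod a)\<^sup>2"
  \<comment> \<open>Conjugating the logarithm, not its argument, makes the sign in
    \<open>Im_x\<close> immediate; \<open>exp\<close> commutes with \<open>cnj\<close>.\<close>
  define x where "x = Ln (1 - cnj ?z * ?w) + (cnj (Ln (1 - cnj a * z)) + Ln (1 - cnj a * w))"
  define y where "y = Ln (of_real k) + Ln (1 - cnj z * w)"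
  have "k > 0"
    using assms(1) by (simp add: k_def abs_square_less_1)
  have lt: "\<bar>Im (Ln (1 - cnj b * c))\<bar> < pi / 2" if "cmod b < 1" "cmod c < 1" for b c
    using Re_one_minus_cnj_mult_pos[OF that] one_minus_cnj_mult_nonzero[OF that] Re_Ln_pos_lt
    by blast
  have z: "cmod ?z < 1" and w: "cmod ?w < 1"
    using Moebius_function_norm_lt_1 assms by blast+
  have Im_y: "Im y = Im (Ln (1 - cnj z * w))"
    using \<open>k > 0\<close> by (simp add: y_def)
  have Im_x: "Im x = Im (Ln (1 - cnj ?z * ?w)) - Im (Ln (1 - cnj a * z)) + Im (Ln (1 - cnj a * w))"
    by (simp add: x_def)
  have "\<bar>Im x - Im y\<bar> < 2 * pi"
    unfolding Im_x Im_y
    using lt[OF z w] lt[OF assms(1,2)] lt[OF assms(1,3)] lt[OF assms(2,3)] by linarith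
  moreover have "exp x = exp y"
  proof -
    have "exp x = (1 - cnj ?z * ?w) * (cnj (1 - cnj a * z) * (1 - cnj a * w))"
      unfolding x_def exp_add exp_cnj[symmetric]
      using one_minus_cnj_mult_nonzero z w assms by (simp only: exp_Ln not_False_eq_True)
    also have "\<dots> = of_real k * (1 - cnj z * w)"
      unfolding k_def using Moebius_function_one_minus_cnj[OF assms] .
    also have "\<dots> = exp y"
      unfolding y_def exp_add
      using one_minus_cnj_mult_nonzero[OF assms(2,3)] \<open>k > 0\<close> by (simp only: exp_Ln of_real_eq_0_iff not_False_eq_True)
    finally show ?thesis .
  qed
  ultimately have "x = y"
    by (rule exp_complex_eqI)
  then have "Im x = Im y"
    by (rule arg_cong)
  then show ?thesis
    unfolding Im_x Im_y by linarith
qed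

section \<open>Area and perimeter as sums around the cycle\<close>

lemma cyc_next_mem:
  assumes "n \<ge> 1"
  shows "cyc_next n k \<in> {1..n}"
  using assms by (simp add: cyc_next_def Suc_leI)

text \<open>The last summand is \<open>f 1\<close> and the others are shifted by one. This is what
  cancels the corrections \<open>g\<close> in \<open>hyp_area_Moebius_function\<close>.\<close>

lemma sum_cyc_next:
  fixes f :: "nat \<Rightarrow> 'a::comm_monoid_add"
  assumes "n \<ge> 1"
  shows "(\<Sum>k=1..n. f (cyc_next n k)) = (\<Sum>k=1..n. f k)"
proof -
  obtain m where n: "n = Suc m"
    using assms by (cases n) auto
  have "(\<Sum>k=1..n. f (cyc_next n k)) = (\<Sum>k=1..m. f (cyc_next n k)) + f 1"
    by (simp add: n cyc_next_def)
  also have "(\<Sum>k=1..m. f (cyc_next n k)) = (\<Sum>k=1..m. f (Suc k))"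
    by (intro sum.cong) (auto simp: n cyc_next_def)
  also have "\<dots> = (\<Sum>k=Suc 1..n. f k)"
    unfolding n by (rule sum.shift_bounds_cl_Suc_ivl[symmetric])
  also have "\<dots> + f 1 = (\<Sum>k=1..n. f k)"
    using assms by (subst (2) sum.atLeast_Suc_atMost) (auto simp: add.commute)
  finally show ?thesis .
qed

lemma hyp_area_eq_Im_Ln:
  assumes "n \<ge> 1" "\<And>k. k \<in> {1..n} \<Longrightarrow> cmod (z k) < 1"
  shows "hyp_area n z = (\<Sum>k=1..n. - 2 * Im (Ln (1 - cnj (z k) * z (cyc_next n k))))"
  unfolding hyp_area_def
  using assms cyc_next_mem[OF assms(1)] arctan_term_eq_Im_Ln by (intro sum.cong) auto

lemma hyp_area_cong:
  assumes "n \<ge> 1" "\<And>k. k \<in> {1..n} \<Longrightarrow> z k = w k"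
  shows "hyp_area n z = hyp_area n w"
  unfolding hyp_area_def
  using assms(2) cyc_next_mem[OF assms(1)] by (intro sum.cong) simp_all

lemma hyp_perimeter_cong:
  assumes "n \<ge> 1" "\<And>k. k \<in> {1..n} \<Longrightarrow> z k = w k"
  shows "hyp_perimeter n z = hyp_perimeter n w"
  unfolding hyp_perimeter_def
  using assms(2) cyc_next_mem[OF assms(1)] by (intro sum.cong) simp_all

lemma hyp_area_Moebius_function:
  assumes "n \<ge> 1" "cmod a < 1" "\<And>k. k \<in> {1..n} \<Longrightarrow> cmod (z k) < 1"
  shows "hyp_area n (\<lambda>k. Moebius_function 0 a (z k)) = hyp_area n z"
proof -
  define g where "g k = 2 * Im (Ln (1 - cnj a * z k))" for k
  have "hyp_area n (\<lambda>k. Moebius_function 0 a (z k))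
      = (\<Sum>k=1..n. - 2 * Im (Ln (1 - cnj (Moebius_function 0 a (z k))
                                   * Moebius_function 0 a (z (cyc_next n k)))))"
    using assms by (intro hyp_area_eq_Im_Ln Moebius_function_norm_lt_1)
  also have "\<dots> = (\<Sum>k=1..n. - 2 * Im (Ln (1 - cnj (z k) * z (cyc_next n k)))
                                 - g k + g (cyc_next n k))"
    using assms(2,3) cyc_next_mem[OF assms(1)]
    by (intro sum.cong) (simp_all add: Im_Ln_Moebius_function g_def)
  also have "\<dots> = hyp_area n z"
    using assms(1,3)
    by (simp only: sum.distrib sum_subtractf sum_cyc_next hyp_area_eq_Im_Ln diff_add_cancel)
  finally show ?thesis .
qed

lemma hyp_perimeter_Moebius_function:
  assumes "n \<ge> 1" "cmod a < 1" "\<And>k. k \<in> {1..n} \<Longrightarrow> cmod (z k) < 1"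
  shows "hyp_perimeter n (\<lambda>k. Moebius_function 0 a (z k)) = hyp_perimeter n z"
  unfolding hyp_perimeter_def
  using assms(2,3) cyc_next_mem[OF assms(1)]
  by (intro sum.cong) (simp_all add: hyp_dist_Moebius_function)

lemma isoperimetric_set_normalize:
  assumes "n \<ge> 1" "r \<in> isoperimetric_set n P"
  obtains s where "s \<in> isoperimetric_set n P" "s 1 = 0" "hyp_area n s = hyp_area n r"
proof -
  define t where "t = (\<lambda>k. Moebius_function 0 (r 1) (r k))"
  \<comment> \<open>Outside \<open>{1..n}\<close> the image of \<open>r k\<close> need not be
    \<open>undefined\<close>; the restriction restores extensionality, as membership in
    \<open>disc_pow\<close> demands.\<close>
  define s where "s = restrict t {1..n}"
  have r: "cmod (r k) < 1" if "k \<in> {1..n}" for k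
    using assms(2) that by (auto simp: isoperimetric_set_def disc_pow_def PiE_iff)
  have r1: "cmod (r 1) < 1"
    using r assms(1) by simp
  have "hyp_perimeter n s = hyp_perimeter n t" "hyp_area n s = hyp_area n t"
    using assms(1) by (auto simp: s_def intro!: hyp_perimeter_cong hyp_area_cong)
  moreover have "hyp_perimeter n t = hyp_perimeter n r" "hyp_area n t = hyp_area n r"
    unfolding t_def using assms(1) r1 r
    by (auto intro!: hyp_perimeter_Moebius_function hyp_area_Moebius_function)
  moreover have "s \<in> disc_pow n"
    using r r1 Moebius_function_norm_lt_1 by (auto simp: s_def t_def disc_pow_def)
  moreover have "s 1 = 0"
    using assms(1) by (simp add: s_def t_def Moebius_function_eq_zero)
  ultimately show thesis
    using that assms(2) by (auto simp: isoperimetric_set_def)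
qed

subsection \<open>Confinement to a compact set\<close>

lemma pseudo_dist_less_1:
  assumes "cmod z < 1" "cmod w < 1"
  shows "cmod ((w - z) / (1 - cnj z * w)) < 1"
  using Moebius_function_norm_lt_1[OF assms, of 0] by (simp add: Moebius_function_simple)

lemma artanh_real_nonneg:
  assumes "0 \<le> x" "x < (1::real)"
  shows "artanh x \<ge> 0"
  using assms by (simp add: artanh_def)

text \<open>By contradiction: (1 + x) / (1 - x) increases strictly on (-1, 1), hence so does half
  its logarithm, which is \<open>artanh\<close>.\<close>

lemma artanh_real_leD:
  assumes "0 \<le> x" "x < 1" "artanh x \<le> (y::real)"
  shows "x \<le> tanh y"
proof (rule ccontr)
  assume "\<not> x \<le> tanh y"
  then have "(1 + tanh y) / (1 - tanh y) < (1 + x) / (1 - x)"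
    using assms by (intro frac_less) (use tanh_real_lt_1[of y] tanh_real_gt_neg1[of y] in auto)
  moreover have "0 < (1 + tanh y) / (1 - tanh y)"
    using tanh_real_lt_1[of y] tanh_real_gt_neg1[of y] by simp
  ultimately have "artanh (tanh y) < artanh x"
    unfolding artanh_def by (simp del: ln_div)
  then show False
    using assms by (simp add: artanh_tanh_real)
qed

lemma tanh_real_sq_less_1: "(tanh (x::real))\<^sup>2 < 1"
  using tanh_real_lt_1[of x] tanh_real_gt_neg1[of x] by (simp add: abs_square_less_1 abs_less_iff)

lemma hyp_dist_nonneg:
  assumes "cmod z < 1" "cmod w < 1"
  shows "hyp_dist z w \<ge> 0"
  using artanh_real_nonneg[OF norm_ge_zero pseudo_dist_less_1[OF assms]] by (simp add: hyp_dist_def)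

text \<open>An edge of bounded length shrinks the Euclidean distance to the unit circle by at most a
  fixed factor. This compares both sides of \<open>one_minus_norm_Moebius_function_sq\<close>, using
  \<open>cmod m\<close> at most \<open>tanh (P / 2)\<close> and \<open>D\<close> at least
  \<open>1 - cmod z\<close>. The 4 comes from bounding \<open>1 + cmod z\<close> and
  \<open>1 + cmod w\<close> by 2.\<close>

lemma hyp_dist_step:
  assumes z: "cmod z < 1" and w: "cmod w < 1" and "hyp_dist z w \<le> P"
  shows "(1 - (tanh (P / 2))\<^sup>2) / 4 * (1 - cmod z) \<le> 1 - cmod w"
proof -
  define \<rho> where "\<rho> = tanh (P / 2)"
  define m where "m = Moebius_function 0 z w"
  define D where "D = cmod (1 - cnj z * w)"
  have "cmod m \<le> \<rho>"
    unfolding \<rho>_def m_def Moebius_function_simple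
    using artanh_real_leD[OF norm_ge_zero pseudo_dist_less_1[OF z w]] assms(3)
    by (simp add: hyp_dist_def)
  then have m: "(cmod m)\<^sup>2 \<le> \<rho>\<^sup>2"
    by (rule power_mono) simp
  have \<rho>: "\<rho>\<^sup>2 < 1"
    by (simp add: \<rho>_def tanh_real_sq_less_1)
  have "1 - cmod z \<le> D"
  proof -
    have "cmod (cnj z * w) \<le> cmod z"
      using w by (simp add: norm_mult mult_left_le)
    then show ?thesis
      unfolding D_def using norm_triangle_ineq2[of 1 "cnj z * w"] by simp
  qed
  have "(1 - \<rho>\<^sup>2) * (1 - cmod z)\<^sup>2 \<le> (1 - (cmod m)\<^sup>2) * D\<^sup>2"
    using m \<rho> \<open>1 - cmod z \<le> D\<close> z by (intro mult_mono power_mono) auto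
  also have "\<dots> = (1 - (cmod z)\<^sup>2) * (1 - (cmod w)\<^sup>2)"
    unfolding m_def D_def using one_minus_norm_Moebius_function_sq[OF z w] .
  also have "\<dots> = (1 - cmod z) * ((1 + cmod z) * ((1 + cmod w) * (1 - cmod w)))"
    by (simp add: power2_eq_square algebra_simps)
  also have "\<dots> \<le> (1 - cmod z) * (2 * (2 * (1 - cmod w)))"
    using z w by (intro mult_mono) auto
  \<comment> \<open>The common positive factor \<open>1 - cmod z\<close> is split off to be
    cancelled, which turns the quadratic estimate into a linear one.\<close>
  finally have "(1 - cmod z) * ((1 - \<rho>\<^sup>2) * (1 - cmod z)) \<le> (1 - cmod z) * (4 * (1 - cmod w))"
    by (simp add: power2_eq_square algebra_simps)
  then have "(1 - \<rho>\<^sup>2) * (1 - cmod z) \<le> 4 * (1 - cmod w)"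
    using z by (simp add: mult_le_cancel_left_pos)
  then show ?thesis
    by (simp add: \<rho>_def)
qed

text \<open>Vertex \<open>Suc k\<close> is \<open>k\<close> edges away from the centre, and each
  edge is no longer than the whole perimeter because all edge lengths are nonnegative. So
  \<open>hyp_dist_step\<close> is iterated \<open>k\<close> times.\<close>

lemma isoperimetric_set_confined:
  assumes "s \<in> isoperimetric_set n P" "s 1 = 0" "k < n"
  shows "((1 - (tanh (P / 2))\<^sup>2) / 4) ^ k \<le> 1 - cmod (s (Suc k))"
  using assms(3)
proof (induction k)
  case 0
  then show ?case
    using assms(2) by simp
next
  case (Suc k)
  let ?c = "(1 - (tanh (P / 2))\<^sup>2) / 4"
  have s: "cmod (s j) < 1" if "j \<in> {1..n}" for j
    using assms(1) that by (auto simp: isoperimetric_set_def disc_pow_def PiE_iff)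
  have "?c \<ge> 0"
    using tanh_real_sq_less_1[of "P / 2"] by simp
  have "hyp_dist (s (Suc k)) (s (cyc_next n (Suc k))) \<le> hyp_perimeter n s"
    unfolding hyp_perimeter_def
    using Suc.prems s cyc_next_mem[of n]
    by (intro member_le_sum[where f = "\<lambda>k. hyp_dist (s k) (s (cyc_next n k))"])
       (auto intro!: hyp_dist_nonneg)
  moreover have "cyc_next n (Suc k) = Suc (Suc k)"
    using Suc.prems by (simp add: cyc_next_def)
  ultimately have "hyp_dist (s (Suc k)) (s (Suc (Suc k))) \<le> P"
    using assms(1) by (simp add: isoperimetric_set_def)
  then have "?c * (1 - cmod (s (Suc k))) \<le> 1 - cmod (s (Suc (Suc k)))"
    using s Suc.prems by (intro hyp_dist_step) auto
  moreover have "?c * ?c ^ k \<le> ?c * (1 - cmod (s (Suc k)))"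
    using Suc.IH Suc.prems \<open>?c \<ge> 0\<close> by (intro mult_left_mono) auto
  ultimately show ?case
    by simp
qed

section \<open>Compactness and continuity on powers of the disc\<close>

lemma compact_PiE_UNIV:
  fixes K :: "'a \<Rightarrow> 'b::topological_space set"
  assumes "\<And>i. compact (K i)"
  shows "compact (Pi\<^sub>E UNIV K)"
  using assms compactin_PiE[of "\<lambda>_. euclidean" UNIV K]
  by (simp add: euclidean_product_topology)

lemma compact_PiE_undefined:
  fixes K :: "'b::topological_space set"
  assumes "compact K"
  shows "compact (I \<rightarrow>\<^sub>E K)"
proof -
  \<comment> \<open>Extensionality amounts to a singleton factor at each index outside
    \<open>I\<close>, so Tychonoff's theorem over the full index type applies.\<close>
  have "(I \<rightarrow>\<^sub>E K) = Pi\<^sub>E UNIV (\<lambda>i. if i \<in> I then K else {undefined})"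
    by (auto simp: PiE_iff extensional_def split: if_splits)
  then show ?thesis
    using assms by (auto intro!: compact_PiE_UNIV)
qed

lemma continuous_on_coordinate:
  "continuous_on A (\<lambda>x :: 'a \<Rightarrow> 'b::topological_space. x i)"
  by (rule continuous_on_subset[OF continuous_on_product_coordinates subset_UNIV])

lemma continuous_on_hyp_perimeter:
  assumes "n \<ge> 1"
  shows "continuous_on (disc_pow n) (hyp_perimeter n)"
proof -
  have disc: "cmod (z k) < 1" "cmod (z (cyc_next n k)) < 1"
    if "z \<in> disc_pow n" "k \<in> {1..n}" for z k
    using that cyc_next_mem[OF assms, of k] by (auto simp: disc_pow_def PiE_iff)
  \<comment> \<open>\<open>artanh\<close> is continuous only on the open interval (-1, 1), so its
    argument has to be kept there.\<close>
  have "cmod ((z (cyc_next n k) - z k) / (1 - cnj (z k) * z (cyc_next n k))) \<in> {-1<..<1}"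
    if "z \<in> disc_pow n" "k \<in> {1..n}" for z k
    using pseudo_dist_less_1[OF disc[OF that]] norm_ge_zero
    by (auto intro: less_le_trans[of "-1" 0])
  then have bound: "(\<lambda>z. cmod ((z (cyc_next n k) - z k) / (1 - cnj (z k) * z (cyc_next n k))))
      ` disc_pow n \<subseteq> {-1<..<1}" if "k \<in> {1..n}" for k
    using that by blast
  have nonzero: "1 - cnj (z k) * z (cyc_next n k) \<noteq> 0" if "z \<in> disc_pow n" "k \<in> {1..n}" for z k
    using one_minus_cnj_mult_nonzero[OF disc[OF that]] .
  show ?thesis
    unfolding hyp_perimeter_def hyp_dist_def
    by (intro continuous_on_sum continuous_on_mult_left continuous_on_norm
          continuous_on_compose2[OF continuous_on_artanh[OF order_refl]]
          continuous_on_divide continuous_on_diff continuous_on_mult continuous_on_cnj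
          continuous_on_const continuous_on_coordinate ballI bound nonzero)
qed

lemma continuous_on_hyp_area:
  assumes "n \<ge> 1"
  shows "continuous_on (disc_pow n) (hyp_area n)"
proof -
  \<comment> \<open>This denominator is the real part of
    \<open>1 - cnj (z k) * z (cyc_next n k)\<close>, hence positive.\<close>
  have "1 - Re (z k) * Re (z (cyc_next n k)) - Im (z k) * Im (z (cyc_next n k)) \<noteq> 0"
    if "z \<in> disc_pow n" "k \<in> {1..n}" for z k
  proof -
    have "cmod (z k) < 1" "cmod (z (cyc_next n k)) < 1"
      using that cyc_next_mem[OF assms, of k] by (auto simp: disc_pow_def PiE_iff)
    from Re_one_minus_cnj_mult_pos[OF this] show ?thesis
      by simp
  qed
  then show ?thesis
    unfolding hyp_area_def
    by (intro continuous_intros continuous_on_coordinate) blast+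
qed

section \<open>Existence of a maximizer\<close>

lemma isoperimetric_set_nonempty:
  assumes "n \<ge> 2" "P \<ge> 0"
  shows "isoperimetric_set n P \<noteq> {}"
proof -
  \<comment> \<open>a segment of length \<open>P / 2\<close> traversed back and forth\<close>
  define t where "t = tanh (P / 4)"
  define r where "r = (\<lambda>k\<in>{1..n}. if k = 1 then complex_of_real t else 0)"
  have t: "0 \<le> t" "t < 1"
    using assms(2) by (simp_all add: t_def tanh_real_lt_1)
  have r: "r k = (if k = 1 then of_real t else 0)" if "k \<in> {1..n}" for k
    using that by (auto simp: r_def)
  \<comment> \<open>Only vertex 1 is off the centre, so only the edges leaving it
    (\<open>k = 1\<close>) and entering it (\<open>k = n\<close>) have nonzero length when P > 0.
    They are distinct as n is at least 2, and each has length 2 artanh (tanh (P / 4)) = P /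
    2.\<close>
  have "hyp_perimeter n r = (\<Sum>k=1..n. (if k = 1 then P / 2 else 0) + (if k = n then P / 2 else 0))"
    unfolding hyp_perimeter_def
  proof (intro sum.cong refl)
    fix k assume k: "k \<in> {1..n}"
    have "cyc_next n k = 1 \<longleftrightarrow> k = n"
      using k by (cases "k = n") (auto simp: cyc_next_def)
    then have next_r: "r (cyc_next n k) = (if k = n then of_real t else 0)"
      using r[OF cyc_next_mem[of n k]] assms(1) by simp
    show "hyp_dist (r k) (r (cyc_next n k))
        = (if k = 1 then P / 2 else 0) + (if k = n then P / 2 else 0)"
      using assms(1) t unfolding next_r r[OF k]
      by (auto simp: hyp_dist_def t_def artanh_tanh_real)
  qed
  also have "\<dots> = P"
    using assms(1) by (simp add: sum.distrib)
  finally have "hyp_perimeter n r = P" .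
  moreover have "r \<in> disc_pow n"
    using t by (auto simp: r_def disc_pow_def)
  ultimately show ?thesis
    by (auto simp: isoperimetric_set_def)
qed

text \<open>Boundedness is asserted as well because \<open>SUP\<close> over an unbounded set of
  reals would be an unspecified value.\<close>

theorem mainTheorem5:
  fixes n :: nat and P :: real
  assumes "n \<ge> 3" and "P > 0"
  shows "bdd_above (hyp_area n ` isoperimetric_set n P) \<and>
    (\<exists>r \<in> isoperimetric_set n P.
       hyp_area n r = (SUP s \<in> isoperimetric_set n P. hyp_area n s))"
proof -
  \<comment> \<open>\<open>c\<close> is the factor lost per edge. A normalized polygon needs at most
    n - 1 steps from the centre, and \<open>c\<close> is at most 1, so \<open>c ^ n\<close> bounds
    the distance of every vertex to the unit circle from below.\<close>
  define c where "c = (1 - (tanh (P / 2))\<^sup>2) / 4"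
  define K where "K = {1..n} \<rightarrow>\<^sub>E cball (0::complex) (1 - c ^ n)"
  define S where "S = {z \<in> K. hyp_perimeter n z = P}"
  have n: "n \<ge> 1"
    using assms(1) by simp
  have "(1 - x) / 4 \<le> 1" if "0 \<le> x" for x :: real
    using that by simp
  then have c: "0 < c" "c \<le> 1"
    using tanh_real_sq_less_1[of "P / 2"] unfolding c_def by (simp, blast intro: zero_le_power2)
  have "c ^ n > 0"
    using c(1) by simp
  then have "cball (0::complex) (1 - c ^ n) \<subseteq> ball 0 1"
    by (intro subsetI) simp
  then have "K \<subseteq> disc_pow n"
    unfolding K_def disc_pow_def by (rule PiE_mono)
  have S_subset: "S \<subseteq> isoperimetric_set n P"
    using \<open>K \<subseteq> disc_pow n\<close> by (auto simp: S_def isoperimetric_set_def)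
  have "compact K"
    unfolding K_def by (intro compact_PiE_undefined compact_cball)
  moreover have "continuous_on K (hyp_perimeter n)"
    using continuous_on_hyp_perimeter[OF n] \<open>K \<subseteq> disc_pow n\<close>
    by (rule continuous_on_subset)
  \<comment> \<open>The perimeter condition is closed relative to \<open>K\<close>, so it is cut out
    of the compact \<open>K\<close> by a closed set.\<close>
  then obtain C where "closed C" and C: "C \<inter> K = hyp_perimeter n -` {P} \<inter> K"
    unfolding continuous_on_closed_invariant by (meson closed_singleton)
  moreover have "S = K \<inter> C"
    using C by (auto simp: S_def)
  ultimately have "compact S"
    by (simp add: compact_Int_closed)
  \<comment> \<open>Every area value on the isoperimetric set already occurs on the compact
    \<open>S\<close>, so a maximum over \<open>S\<close> is a global one.\<close>
  have normalize: "\<exists>s\<in>S. hyp_area n s = hyp_area n r" if "r \<in> isoperimetric_set n P" for r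
  proof -
    obtain s where s: "s \<in> isoperimetric_set n P" "s 1 = 0" "hyp_area n s = hyp_area n r"
      using isoperimetric_set_normalize[OF n \<open>r \<in> _\<close>] .
    have "cmod (s k) \<le> 1 - c ^ n" if k: "k \<in> {1..n}" for k
    proof -
      obtain j where j: "k = Suc j" "j < n"
        using k by (cases k) auto
      have "c ^ n \<le> c ^ j"
        using c j by (intro power_decreasing) auto
      then show ?thesis
        using isoperimetric_set_confined[OF s(1,2) j(2)] j(1) by (simp add: c_def)
    qed
    then have "s \<in> S"
      using s(1) by (auto simp: S_def K_def isoperimetric_set_def disc_pow_def PiE_iff)
    then show ?thesis
      using s(3) by blast
  qed
  have "S \<noteq> {}"
    using isoperimetric_set_nonempty[of n P] normalize assms by fastforce
  moreover have "continuous_on S (hyp_area n)"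
    using \<open>K \<subseteq> disc_pow n\<close>
    by (intro continuous_on_subset[OF continuous_on_hyp_area[OF n]]) (auto simp: S_def)
  ultimately obtain r where "r \<in> S" and r: "\<And>s. s \<in> S \<Longrightarrow> hyp_area n s \<le> hyp_area n r"
    using continuous_attains_sup[OF \<open>compact S\<close>] by blast
  have max: "hyp_area n s \<le> hyp_area n r" if "s \<in> isoperimetric_set n P" for s
    using normalize[OF that] r by metis
  have mem: "r \<in> isoperimetric_set n P"
    using \<open>r \<in> S\<close> S_subset by blast
  have "(SUP s \<in> isoperimetric_set n P. hyp_area n s) = hyp_area n r"
    using mem max by (intro cSup_eq_maximum) auto
  moreover have "bdd_above (hyp_area n ` isoperimetric_set n P)"
    using max by (rule bdd_aboveI2)
  ultimately show ?thesis
    using mem by metis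
qed

end
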